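(* For any $R,S,T\in\mathbb{Q}$, \begin{align*} &\operatorname{Diag}\big((1-x)^R(1-x-y)^S(1-x-y-z)^T\big)=\\ &{}_6F_5\Big(\Big[\tfrac{-(R+S+T)}{3},\tfrac{1-(R+S+T)}{3},\tfrac{2-(R+S+T)}{3},\tfrac{-(S+T)}{2},\tfrac{1-(S+T)}{2},-T\Big];\Big[\tfrac{-(R+S+T)}{2},\tfrac{1-(R+S+T)}{2},-(S+T),1,1\Big];27t\Big) \end{align*} and \begin{align*} &\operatorname{Diag}\big((1-x)^R(1-x-2y)^S(1-x-y-z)^{-1}\big)=\\ &{}_4F_3\Big(\Big[\tfrac{1-(R+S)}{3},\tfrac{2-(R+S)}{3},\tfrac{3-(R+S)}{3},\tfrac{1-S}{2}\Big];\Big[\tfrac{1-(R+S)}{2},\tfrac{2-(R+S)}{2},1\Big];27t\Big). \end{align*}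
   Context: All power series have coefficients in $\mathbb{Q}$. For $a\in\mathbb{Q}$ and a power series $L$ with zero constant term, $(1+L)^a:=\sum_{j\ge0}\binom{a}{j}L^j$, where $\binom{a}{j}=a(a-1)\cdots(a-j+1)/j!$. For $g=\sum g_{i,j,k}x^iy^jz^k$, $\operatorname{Diag}(g):=\sum_{m\ge0}g_{m,m,m}t^m$. The generalized hypergeometric function is ${}_pF_q([a_1,\dots,a_p];[b_1,\dots,b_q];t):=\sum_{j\ge0}\frac{(a_1)_j\cdots(a_p)_j}{(b_1)_j\cdots(b_q)_j}\frac{t^j}{j!}$ with $(x)_j=x(x+1)\cdots(x+j-1)$, defined when no $b_i+j$ ($j\in\mathbb{N}$) vanishes. *)

theory Defs
  imports "HOL-Computational_Algebra.Formal_Power_Series" "HOL-Library.Groups_Big_Fun"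
begin

text \<open>
  The ring of power series in \<open>x, y, z\<close> over the rationals is represented as the iterated ring
  \<open>\<rat>[[x]][[y]][[z]]\<close>; the variable of the outermost series is \<open>z\<close>.
\<close>

type_synonym fps3 = "rat fps fps fps"

definition X3 :: fps3 where "X3 = fps_const (fps_const fps_X)"
definition Y3 :: fps3 where "Y3 = fps_const fps_X"
definition Z3 :: fps3 where "Z3 = fps_X"

definition coeff3 :: "fps3 \<Rightarrow> nat \<Rightarrow> nat \<Rightarrow> nat \<Rightarrow> rat" where
  "coeff3 g i j k = fps_nth (fps_nth (fps_nth g k) j) i"

definition Abs_fps3 :: "(nat \<Rightarrow> nat \<Rightarrow> nat \<Rightarrow> rat) \<Rightarrow> fps3" where
  "Abs_fps3 c = Abs_fps (\<lambda>k. Abs_fps (\<lambda>j. Abs_fps (\<lambda>i. c i j k)))"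

definition Diag :: "fps3 \<Rightarrow> rat fps" where
  "Diag g = Abs_fps (\<lambda>m. coeff3 g m m m)"

text \<open>
  \<open>F\<^sup>a = (1 + L)\<^sup>a = \<Sum>n\<ge>0. (a choose n) L\<^sup>n\<close> for \<open>L = F - 1\<close>, meaningful when \<open>L\<close> has zero
  constant term. The infinite sum is taken coefficientwise: then only finitely many \<open>n\<close>
  contribute to each coefficient (lemma \<open>coeff3_power_eq_0\<close> below). The topology that the
  library puts on the iterated ring is only \<open>z\<close>-adic, so \<^const>\<open>suminf\<close> would not do.
\<close>

definition fps3_pow :: "fps3 \<Rightarrow> rat \<Rightarrow> fps3"  (infixr \<open>pow3\<close> 80) where
  "F pow3 a = Abs_fps3 (\<lambda>i j k. Sum_any (\<lambda>n. (a gchoose n) * coeff3 ((F - 1) ^ n) i j k))"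

text \<open>
  Whether the hypergeometric series with lower parameters \<open>bs\<close> is defined. This is needed because
  \<^const>\<open>fps_hypergeo\<close> is total, with division by zero giving zero.
\<close>

definition hypergeo_defined :: "rat list \<Rightarrow> bool" where
  "hypergeo_defined bs \<longleftrightarrow> (\<forall>b \<in> set bs. \<forall>j::nat. b + of_nat j \<noteq> 0)"

lemma coeff3_Abs_fps3 [simp]: "coeff3 (Abs_fps3 c) i j k = c i j k"
  by (simp add: coeff3_def Abs_fps3_def)

lemma fps3_eqI: "(\<And>i j k. coeff3 f i j k = coeff3 g i j k) \<Longrightarrow> f = g"
  by (simp add: coeff3_def fps_eq_iff)

lemma coeff3_mult:
  "coeff3 (f * g) i j k =
    (\<Sum>k'=0..k. \<Sum>j'=0..j. \<Sum>i'=0..i. coeff3 f i' j' k' * coeff3 g (i - i') (j - j') (k - k'))"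
  by (simp add: coeff3_def fps_mult_nth fps_sum_nth)

lemma coeff3_power_eq_0:
  assumes "coeff3 L 0 0 0 = 0" and "n > i + j + k"
  shows "coeff3 (L ^ n) i j k = 0"
  using assms(2)
proof (induction n arbitrary: i j k)
  case 0
  then show ?case by simp
next
  case (Suc n)
  have "coeff3 L i' j' k' * coeff3 (L ^ n) (i - i') (j - j') (k - k') = 0"
    if "i' \<le> i" "j' \<le> j" "k' \<le> k" for i' j' k'
  proof (cases "i' = 0 \<and> j' = 0 \<and> k' = 0")
    case True
    then show ?thesis using assms(1) by simp
  next
    case False
    then have "(i - i') + (j - j') + (k - k') < n" using that Suc.prems by linarith
    then show ?thesis using Suc.IH by simp
  qed
  then show ?case by (simp only: power_Suc coeff3_mult) (intro sum.neutral ballI, simp)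
qed

lemma coeff3_one_plus_pow3:
  assumes "coeff3 L 0 0 0 = 0"
  shows "coeff3 ((1 + L) pow3 a) i j k = (\<Sum>n\<le>i + j + k. (a gchoose n) * coeff3 (L ^ n) i j k)"
proof -
  have "{n. (a gchoose n) * coeff3 (L ^ n) i j k \<noteq> 0} \<subseteq> {..i + j + k}"
    using coeff3_power_eq_0[OF assms] by (force simp: not_less[symmetric])
  then show ?thesis by (simp add: fps3_pow_def Sum_any.expand_superset)
qed

end

theory Submission
  imports Defs
begin

text \<open>
  Expanding in \<open>z\<close>, then \<open>y\<close>, then \<open>x\<close>, the \<open>m\<close>-th diagonal coefficient of
  \<open>(1 - x)\<^sup>R (1 - x - c y)\<^sup>S (1 - x - y - z)\<^sup>T\<close> is, up to sign, the product of \<open>T\<close> choose \<open>m\<close>,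
  of \<open>R + S + T - 2m\<close> choose \<open>m\<close>, and of the coefficient of \<open>w\<^sup>m\<close> in \<open>(1 - c w)\<^sup>S (1 - w)\<^bsup>T - m\<^esup>\<close>.
  For \<open>c = 1\<close> the last factor is \<open>S + T - m\<close> choose \<open>m\<close>, again up to sign. For \<open>c = 2\<close> and \<open>T = -1\<close>
  it is found by Lagrange inversion: with \<open>v = w (1 - w)\<close> one has \<open>(1 - 2w)\<^sup>2 = 1 - 4v\<close>, and only the
  term \<open>v\<^sup>m\<close> of \<open>(1 - 4v)\<^bsup>(S - 1)/2\<^esup>\<close> contributes. The multiplication formulas for Pochhammer
  symbols at \<open>2m\<close> and \<open>3m\<close> then give the hypergeometric parameters.
\<close>

section \<open>Binomial series in one variable\<close>

definition one_minus_pow :: "'a::field_char_0 \<Rightarrow> 'a \<Rightarrow> 'a fps" where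
  "one_minus_pow c a = Abs_fps (\<lambda>n. (- c) ^ n * (a gchoose n))"

lemma one_minus_pow_nth [simp]: "fps_nth (one_minus_pow c a) n = (- c) ^ n * (a gchoose n)"
  by (simp add: one_minus_pow_def)

lemma one_minus_pow_0 [simp]: "one_minus_pow c 0 = 1"
proof (rule fps_ext)
  fix n show "fps_nth (one_minus_pow c 0) n = fps_nth 1 n"
    by (cases n) auto
qed

lemma one_minus_pow_1 [simp]: "one_minus_pow c 1 = 1 - fps_const c * fps_X"
proof (rule fps_ext)
  fix n show "fps_nth (one_minus_pow c 1) n = fps_nth (1 - fps_const c * fps_X) n"
  proof (cases n)
    case (Suc m)
    then show ?thesis
      \<comment> \<open>For n >= 2 the product in the numerator of \<open>1 gchoose n\<close>
        contains the factor 1 - 1.\<close>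
      by (cases m) (auto simp: gbinomial_prod_rev prod.atLeast0_lessThan_Suc_shift)
  qed simp
qed

lemma one_minus_pow_mult: "one_minus_pow c a * one_minus_pow c b = one_minus_pow c (a + b)"
proof (rule fps_ext)
  fix n
  have "fps_nth (one_minus_pow c a * one_minus_pow c b) n =
      (\<Sum>i=0..n. (- c) ^ n * ((a gchoose i) * (b gchoose (n - i))))"
    unfolding fps_mult_nth
  proof (rule sum.cong)
    fix i assume "i \<in> {0..n}"
    then have "(- c) ^ n = (- c) ^ i * (- c) ^ (n - i)"
      by (simp flip: power_add)
    then show "fps_nth (one_minus_pow c a) i * fps_nth (one_minus_pow c b) (n - i) =
        (- c) ^ n * ((a gchoose i) * (b gchoose (n - i)))"
      by (simp add: mult_ac)
  qed simp
  also have "\<dots> = (- c) ^ n * ((a + b) gchoose n)"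
    by (simp add: gbinomial_Vandermonde sum_distrib_left[symmetric])
  finally show "fps_nth (one_minus_pow c a * one_minus_pow c b) n = fps_nth (one_minus_pow c (a + b)) n"
    by simp
qed

lemma power_one_minus_pow: "one_minus_pow c a ^ n = one_minus_pow c (of_nat n * a)"
  by (induction n) (simp_all add: one_minus_pow_mult algebra_simps)

lemma gbinomial_Suc_rec:
  fixes a :: "'a::field_char_0"
  shows "of_nat (Suc n) * (a gchoose Suc n) = (a - of_nat n) * (a gchoose n)"
  using gbinomial_mult_1[of a n] by (simp add: algebra_simps)

lemma one_minus_mult_deriv_nth:
  fixes f :: "'a::field_char_0 fps"
  shows "fps_nth ((1 - fps_const c * fps_X) * fps_deriv f) n =
    of_nat (Suc n) * fps_nth f (Suc n) - c * (of_nat n * fps_nth f n)"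
proof -
  have "(1 - fps_const c * fps_X) * fps_deriv f = fps_deriv f - fps_const c * (fps_X * fps_deriv f)"
    by (simp add: left_diff_distrib mult.assoc)
  then show ?thesis
    by (cases n) (simp_all del: of_nat_Suc)
qed

lemma one_minus_pow_deriv:
  "(1 - fps_const c * fps_X) * fps_deriv (one_minus_pow c a) = fps_const (- c * a) * one_minus_pow c a"
proof (rule fps_ext)
  fix n
  show "fps_nth ((1 - fps_const c * fps_X) * fps_deriv (one_minus_pow c a)) n =
      fps_nth (fps_const (- c * a) * one_minus_pow c a) n"
    unfolding one_minus_mult_deriv_nth fps_mult_left_const_nth one_minus_pow_nth
      mult.left_commute[of "of_nat (Suc n)"] gbinomial_Suc_rec
    by (simp add: algebra_simps)
qed

text \<open>The differential equation is a first-order recurrence for the coefficients whose leading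
  factor n + 1 is invertible in characteristic 0, so the constant term determines the series. This
  identifies a composed series without expanding it.\<close>

lemma one_minus_pow_unique:
  fixes f :: "'a::field_char_0 fps"
  assumes ode: "(1 - fps_const c * fps_X) * fps_deriv f = fps_const (- c * a) * f"
    and init: "fps_nth f 0 = 1"
  shows "f = one_minus_pow c a"
proof (rule fps_ext)
  fix n
  show "fps_nth f n = fps_nth (one_minus_pow c a) n"
  proof (induction n)
    case (Suc n)
    have rec: "of_nat (Suc n) * fps_nth g (Suc n) = - c * (a - of_nat n) * fps_nth g n"
      if "(1 - fps_const c * fps_X) * fps_deriv g = fps_const (- c * a) * g" for g :: "'a fps"
    proof -
      have "fps_nth ((1 - fps_const c * fps_X) * fps_deriv g) n = fps_nth (fps_const (- c * a) * g) n"
        using that by simp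
      then show ?thesis
        unfolding one_minus_mult_deriv_nth fps_mult_left_const_nth
        by (simp add: algebra_simps del: of_nat_Suc)
    qed
    have "of_nat (Suc n) * fps_nth f (Suc n) = of_nat (Suc n) * fps_nth (one_minus_pow c a) (Suc n)"
      unfolding rec[OF ode] rec[OF one_minus_pow_deriv] Suc.IH ..
    then show ?case
      by (simp del: of_nat_Suc one_minus_pow_nth)
  qed (use init in simp)
qed

section \<open>The substitution v = w (1 - w) and Lagrange inversion\<close>

text \<open>Substitute v into the differential equation of (1 - 4v)^a and multiply by v' = 1 - 2w.
  Since 1 - 4v = (1 - 2w)^2, cancelling one factor 1 - 2w leaves the equation of (1 -
  2w)^(2a).\<close>

lemma one_minus_pow_compose:
  fixes a :: "'a::field_char_0"
  shows "one_minus_pow 4 a oo (fps_X * (1 - fps_X)) = one_minus_pow 2 (2 * a)"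
    (is "?f oo ?v = _")
proof (rule one_minus_pow_unique)
  have v0: "fps_nth ?v 0 = 0" by simp
  have "(1 - fps_const 4 * ?v) * (fps_deriv ?f oo ?v)
      = ((1 - fps_const 4 * fps_X) * fps_deriv ?f) oo ?v"
    by (simp add: fps_compose_mult_distrib[OF v0] fps_compose_sub_distrib)
  also have "\<dots> = fps_const (- 4 * a) * (?f oo ?v)"
    by (simp only: one_minus_pow_deriv fps_compose_mult_distrib[OF v0] fps_const_compose)
  finally have *: "(1 - fps_const 4 * ?v) * (fps_deriv ?f oo ?v) = fps_const (- 4 * a) * (?f oo ?v)" .
  have dv: "fps_deriv ?v = 1 - fps_const 2 * fps_X"
    by (simp add: algebra_simps numeral_fps_const[symmetric])
  have sq: "1 - fps_const 4 * ?v = (1 - fps_const 2 * fps_X) * (1 - fps_const 2 * fps_X)"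
    by (simp add: algebra_simps numeral_fps_const[symmetric])
  have ne: "1 - fps_const 2 * fps_X \<noteq> (0 :: 'a fps)"
  proof
    assume "1 - fps_const 2 * fps_X = (0 :: 'a fps)"
    then have "fps_nth (1 - fps_const 2 * fps_X :: 'a fps) 0 = 0" by (simp only: fps_zero_nth)
    then show False by simp
  qed
  have "(1 - fps_const 2 * fps_X) * ((1 - fps_const 2 * fps_X) * fps_deriv (?f oo ?v))
      = (1 - fps_const 2 * fps_X) * (fps_const (- 2 * (2 * a)) * (?f oo ?v))"
    using * unfolding sq fps_compose_deriv[OF v0] dv by (simp add: mult_ac)
  then show "(1 - fps_const 2 * fps_X) * fps_deriv (?f oo ?v) = fps_const (- 2 * (2 * a)) * (?f oo ?v)"
    using ne by (simp only: mult_cancel_left) simp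
qed simp

lemma fps_compose_mult_nth:
  fixes f v g :: "'a::idom fps"
  assumes v0: "fps_nth v 0 = 0"
  shows "fps_nth ((f oo v) * g) n = (\<Sum>i\<le>n. fps_nth f i * fps_nth (v ^ i * g) n)"
proof -
  \<comment> \<open>As v^i has order at least i, the sum may run up to n for every l <= n; a range
    independent of l allows the sums to be swapped.\<close>
  have ext: "fps_nth (f oo v) l = (\<Sum>i\<le>n. fps_nth f i * fps_nth (v ^ i) l)" if "l \<le> n" for l
    unfolding fps_compose_nth
    by (rule sum.mono_neutral_left) (use that startsby_zero_power_prefix[OF v0] in auto)
  have "fps_nth ((f oo v) * g) n = (\<Sum>l=0..n. \<Sum>i\<le>n. fps_nth f i * (fps_nth (v ^ i) l * fps_nth g (n - l)))"
    unfolding fps_mult_nth by (rule sum.cong) (auto simp: ext sum_distrib_right mult.assoc)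
  also have "\<dots> = (\<Sum>i\<le>n. \<Sum>l=0..n. fps_nth f i * (fps_nth (v ^ i) l * fps_nth g (n - l)))"
    by (rule sum.swap)
  finally show ?thesis by (simp add: fps_mult_nth sum_distrib_left)
qed

text \<open>In (1 - w)^(-1-d) the coefficient of w^d is twice that of w^(d-1), because the
  recurrence factor (-1 - d) - (d - 1) equals -2d. In residue terms, v^(-d-1) dv has no residue for
  d > 0.\<close>

lemma one_minus_pow_central_coeff_eq_0:
  fixes d :: nat
  assumes "d > 0"
  shows "fps_nth (one_minus_pow 1 (- 1 - of_nat d) * (1 - fps_const 2 * fps_X) :: 'a::field_char_0 fps) d = 0"
proof -
  obtain e where d: "d = Suc e" using assms by (cases d) auto
  have "of_nat (Suc e) * ((- 1 - of_nat d :: 'a) gchoose Suc e) = of_nat (Suc e) * (- 2 * ((- 1 - of_nat d) gchoose e))"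
    unfolding gbinomial_Suc_rec by (simp add: d algebra_simps)
  then have "((- 1 - of_nat d :: 'a) gchoose Suc e) = - 2 * ((- 1 - of_nat d) gchoose e)"
    unfolding mult_cancel_left using of_nat_neq_0 by blast
  moreover have "f * (1 - fps_const 2 * fps_X) = f - fps_const 2 * (fps_X * f)" for f :: "'a fps"
    by (simp add: right_diff_distrib mult_ac)
  ultimately show ?thesis
    by (simp add: d del: of_nat_Suc)
qed

text \<open>Expand (1 - 2w)^S = (1 - 4v)^a (1 - 2w) in powers of v. The factor (1 - w)^i of v^i
  turns the exponent -1 - m into -1 - (m - i), so the preceding vanishing result removes every term
  with i < m.\<close>

lemma coeff_one_minus_pow_2_mult:
  fixes S :: "'a::field_char_0"
  shows "fps_nth (one_minus_pow 2 S * one_minus_pow 1 (- 1 - of_nat m)) m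
    = (- 4) ^ m * (((S - 1) / 2) gchoose m)"
proof -
  define a where "a = (S - 1) / 2"
  define K :: "'a fps" where "K = one_minus_pow 1 (- 1 - of_nat m) * (1 - fps_const 2 * fps_X)"
  let ?v = "fps_X * (1 - fps_X) :: 'a fps"
  \<comment> \<open>One factor 1 - 2w = v' is split off, whence the exponent (S - 1)/2.\<close>
  have "one_minus_pow 2 S = one_minus_pow 2 (2 * a) * one_minus_pow 2 1"
    unfolding one_minus_pow_mult by (simp add: a_def field_simps)
  then have "one_minus_pow 2 S * one_minus_pow 1 (- 1 - of_nat m) = (one_minus_pow 4 a oo ?v) * K"
    by (simp add: one_minus_pow_compose K_def mult_ac)
  also have "fps_nth \<dots> m = (\<Sum>i\<le>m. fps_nth (one_minus_pow 4 a) i * fps_nth (?v ^ i * K) m)"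
    by (rule fps_compose_mult_nth) simp
  also have "\<dots> = (\<Sum>i\<le>m. if i = m then fps_nth (one_minus_pow 4 a) m else 0)"
  proof (rule sum.cong)
    fix i assume "i \<in> {..m}"
    then have i: "i \<le> m" by simp
    have "(1 - fps_X) ^ i * one_minus_pow 1 (- 1 - of_nat m) = (one_minus_pow 1 (- 1 - of_nat (m - i)) :: 'a fps)"
      using power_one_minus_pow[of 1 "1::'a" i] i
      by (simp add: one_minus_pow_mult of_nat_diff algebra_simps)
    then have "?v ^ i * K = fps_X ^ i * (one_minus_pow 1 (- 1 - of_nat (m - i)) * (1 - fps_const 2 * fps_X))"
      by (simp add: K_def power_mult_distrib mult.assoc[symmetric])
    then have "fps_nth (?v ^ i * K) m =
        fps_nth (one_minus_pow 1 (- 1 - of_nat (m - i)) * (1 - fps_const 2 * fps_X)) (m - i)"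
      using i by (simp only: fps_X_power_mult_nth not_less[symmetric] if_False)
    also have "\<dots> = (if i = m then 1 else 0)"
    proof (cases "i = m")
      case False
      then show ?thesis using i one_minus_pow_central_coeff_eq_0[of "m - i", where 'a = 'a] by simp
    qed simp
    finally show "fps_nth (one_minus_pow 4 a) i * fps_nth (?v ^ i * K) m
        = (if i = m then fps_nth (one_minus_pow 4 a) m else 0)"
      by simp
  qed simp
  finally show ?thesis by (simp add: a_def)
qed

section \<open>Expansion of powers of linear forms in three variables\<close>

text \<open>Stated over any commutative ring so that \<open>p\<close> and \<open>q\<close> can
  themselves be series in the inner variables.\<close>

lemma fps_linear_power_nth:
  fixes p q :: "'a::comm_ring_1"
  shows "fps_nth ((fps_const p + fps_const q * fps_X) ^ n) k = of_nat (n choose k) * p ^ (n - k) * q ^ k"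
proof -
  have "(fps_const p + fps_const q * fps_X) ^ n
      = (\<Sum>i\<le>n. fps_const (of_nat (n choose i) * p ^ (n - i) * q ^ i) * fps_X ^ i)"
    by (subst add.commute, subst binomial_ring)
       (simp add: power_mult_distrib fps_const_power mult_ac fps_of_nat[symmetric] flip: fps_const_mult)
  then show ?thesis
    by (simp add: fps_sum_nth fps_X_power_nth if_distrib binomial_eq_0 cong: if_cong)
qed

lemma coeff3_linear_power:
  fixes c d :: rat
  shows "coeff3 ((- X3 - fps_const (fps_const (fps_const c)) * Y3
        - fps_const (fps_const (fps_const d)) * Z3) ^ n) i j k =
     (if n = i + j + k
      then of_nat (n choose k) * of_nat (n - k choose j) * (- 1) ^ i * (- c) ^ j * (- d) ^ k else 0)"
proof -
  let ?u = "fps_const (- 1) * fps_X :: rat fps"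
  let ?v = "fps_const ?u + fps_const (fps_const (- c)) * fps_X :: rat fps fps"
  have eq: "- X3 - fps_const (fps_const (fps_const c)) * Y3 - fps_const (fps_const (fps_const d)) * Z3
      = fps_const ?v + fps_const (fps_const (fps_const (- d))) * fps_X"
    by (simp add: X3_def Y3_def Z3_def fps_eq_iff)
  have 1: "fps_nth ((fps_const ?v + fps_const (fps_const (fps_const (- d))) * fps_X) ^ n) k
      = fps_const (fps_const (of_nat (n choose k) * (- d) ^ k)) * ?v ^ (n - k)"
    unfolding fps_linear_power_nth by (simp add: fps_of_nat[symmetric] fps_const_power mult_ac flip: fps_const_mult)
  have 2: "fps_nth (?v ^ l) j = fps_const (of_nat (l choose j) * (- c) ^ j) * ?u ^ (l - j)" for l
    unfolding fps_linear_power_nth by (simp add: fps_of_nat[symmetric] fps_const_power mult_ac flip: fps_const_mult)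
  have 3: "fps_nth (?u ^ l) i = (if i = l then (- 1) ^ l else 0)" for l
    by (simp only: power_mult_distrib fps_const_power fps_mult_left_const_nth fps_X_power_nth) simp
  show ?thesis
    \<comment> \<open>If k > n or j > n - k, subtraction truncates, but then a binomial coefficient
      is 0.\<close>
    unfolding eq coeff3_def 1 fps_mult_left_const_nth 2 3
    by (auto simp: binomial_eq_0)
qed

text \<open>By homogeneity only the power n = i + j + k contributes. Trinomial revision, applied
  twice, turns its multinomial coefficient into one binomial per variable, the exponent dropping by
  the degrees already extracted.\<close>

lemma coeff3_linear_pow3:
  fixes a c d :: rat
  shows "coeff3 ((1 - X3 - fps_const (fps_const (fps_const c)) * Y3
        - fps_const (fps_const (fps_const d)) * Z3) pow3 a) i j k =
     (- d) ^ k * (a gchoose k) * ((- c) ^ j * (a - of_nat k gchoose j)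
       * ((- 1) ^ i * (a - of_nat k - of_nat j gchoose i)))"
proof -
  let ?L = "- X3 - fps_const (fps_const (fps_const c)) * Y3 - fps_const (fps_const (fps_const d)) * Z3"
  have L0: "coeff3 ?L 0 0 0 = 0"
    by (simp add: coeff3_def X3_def Y3_def Z3_def)
  have "coeff3 ((1 + ?L) pow3 a) i j k =
      (a gchoose (i + j + k)) * of_nat (i + j + k choose k) * of_nat (i + j choose j)
        * (- 1) ^ i * (- c) ^ j * (- d) ^ k"
    unfolding coeff3_one_plus_pow3[OF L0] coeff3_linear_power
    by (simp add: if_distrib mult_ac cong: if_cong)
  also have "(a gchoose (i + j + k)) * of_nat (i + j + k choose k) = (a gchoose k) * (a - of_nat k gchoose (i + j))"
    using gbinomial_trinomial_revision[of k "i + j + k" a] by (simp add: binomial_gbinomial)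
  also have "(a gchoose k) * (a - of_nat k gchoose (i + j)) * of_nat (i + j choose j) =
      (a gchoose k) * ((a - of_nat k gchoose j) * (a - of_nat k - of_nat j gchoose i))"
    using gbinomial_trinomial_revision[of j "i + j" "a - of_nat k"] by (simp add: binomial_gbinomial)
  finally show ?thesis by (simp add: algebra_simps)
qed

text \<open>The series \<open>(1 - x - c y)\<^sup>a\<close>, expanded in \<open>y\<close>.\<close>

definition two_var_pow :: "rat \<Rightarrow> rat \<Rightarrow> rat fps fps" where
  "two_var_pow c a = Abs_fps (\<lambda>j. fps_const ((- c) ^ j * (a gchoose j)) * one_minus_pow 1 (a - of_nat j))"

text \<open>With free \<open>c\<close> and \<open>d\<close> this covers all three factors:
  \<open>d = 0\<close> removes z and \<open>c = 0\<close> then removes y, as 0^0 = 1 keeps only the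
  constant term.\<close>

lemma linear_pow3:
  "(1 - X3 - fps_const (fps_const (fps_const c)) * Y3 - fps_const (fps_const (fps_const d)) * Z3) pow3 a
    = Abs_fps (\<lambda>k. fps_const (fps_const ((- d) ^ k * (a gchoose k))) * two_var_pow c (a - of_nat k))"
  by (rule fps3_eqI, unfold coeff3_linear_pow3) (simp add: coeff3_def two_var_pow_def)

lemma two_var_pow_0: "two_var_pow 0 a = fps_const (one_minus_pow 1 a)"
  by (rule fps_ext) (simp add: two_var_pow_def power_0_left)

lemma one_minus_x_y_pow3:
  "(1 - X3 - fps_const (fps_const (fps_const c)) * Y3) pow3 a = fps_const (two_var_pow c a)"
proof -
  have "Abs_fps (\<lambda>k. fps_const (fps_const ((- 0) ^ k * (a gchoose k))) * two_var_pow c (a - of_nat k))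
      = fps_const (two_var_pow c a)"
    by (rule fps_ext) (simp add: power_0_left)
  then show ?thesis using linear_pow3[of c 0 a] by simp
qed

lemma one_minus_x_pow3: "(1 - X3) pow3 a = fps_const (fps_const (one_minus_pow 1 a))"
  using one_minus_x_y_pow3[of 0 a] by (simp add: two_var_pow_0)

lemma one_minus_x_y_z_pow3:
  "(1 - X3 - Y3 - Z3) pow3 a
    = Abs_fps (\<lambda>k. fps_const (fps_const ((- 1) ^ k * (a gchoose k))) * two_var_pow 1 (a - of_nat k))"
  using linear_pow3[of 1 1 a] by simp

section \<open>Coefficients of the product and its diagonal\<close>

text \<open>The exponents of 1 - x in each summand, a - j and b - (m - j), add up to a + b - m
  independently of j. The power of 1 - x therefore leaves the sum, and a one-variable convolution
  remains.\<close>

lemma two_var_pow_mult_nth: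
  "fps_nth (two_var_pow c a * two_var_pow d b) m =
    fps_const (fps_nth (one_minus_pow c a * one_minus_pow d b) m) * one_minus_pow 1 (a + b - of_nat m)"
proof -
  have "fps_nth (two_var_pow c a * two_var_pow d b) m =
    (\<Sum>j=0..m. fps_const (((- c) ^ j * (a gchoose j)) * ((- d) ^ (m - j) * (b gchoose (m - j))))
       * one_minus_pow 1 (a + b - of_nat m))"
    unfolding fps_mult_nth
  proof (rule sum.cong)
    fix j assume "j \<in> {0..m}"
    then have "one_minus_pow 1 (a - of_nat j) * one_minus_pow 1 (b - of_nat (m - j))
        = one_minus_pow 1 (a + b - of_nat m)"
      by (simp add: one_minus_pow_mult of_nat_diff algebra_simps)
    then show "fps_nth (two_var_pow c a) j * fps_nth (two_var_pow d b) (m - j) =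
        fps_const (((- c) ^ j * (a gchoose j)) * ((- d) ^ (m - j) * (b gchoose (m - j))))
          * one_minus_pow 1 (a + b - of_nat m)"
      by (simp add: two_var_pow_def mult_ac flip: fps_const_mult)
  qed simp
  also have "\<dots> = fps_const (fps_nth (one_minus_pow c a * one_minus_pow d b) m) * one_minus_pow 1 (a + b - of_nat m)"
    unfolding sum_distrib_right[symmetric]
    by (rule arg_cong[where f = "\<lambda>f. f * _"]) (simp add: fps_eq_iff fps_mult_nth fps_sum_nth)
  finally show ?thesis .
qed

text \<open>Only the third factor involves z, so extracting z^m lowers T to T - m. The first factor
  is free of y, so y^m comes from the other two and costs another m, leaving (1 -
  x)^(R+S+T-2m).\<close>

lemma Diag_nth:
  "fps_nth (Diag ((1 - X3) pow3 R * (1 - X3 - fps_const (fps_const (fps_const c)) * Y3) pow3 S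
      * (1 - X3 - Y3 - Z3) pow3 T)) m =
    (- 1) ^ m * (T gchoose m) * fps_nth (one_minus_pow c S * one_minus_pow 1 (T - of_nat m)) m
      * ((- 1) ^ m * (R + S + T - 2 * of_nat m gchoose m))"
proof -
  have "fps_nth ((1 - X3) pow3 R * (1 - X3 - fps_const (fps_const (fps_const c)) * Y3) pow3 S
      * (1 - X3 - Y3 - Z3) pow3 T) m =
    fps_const (fps_const ((- 1) ^ m * (T gchoose m))) *
      (fps_const (one_minus_pow 1 R) * (two_var_pow c S * two_var_pow 1 (T - of_nat m)))"
    unfolding one_minus_x_pow3 one_minus_x_y_pow3 one_minus_x_y_z_pow3
    by (simp only: mult.assoc fps_mult_left_const_nth fps_nth_Abs_fps) (simp only: mult_ac)
  then have "fps_nth (fps_nth ((1 - X3) pow3 R * (1 - X3 - fps_const (fps_const (fps_const c)) * Y3) pow3 S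
      * (1 - X3 - Y3 - Z3) pow3 T) m) m =
    fps_const ((- 1) ^ m * (T gchoose m)) *
      (one_minus_pow 1 R * fps_nth (two_var_pow c S * two_var_pow 1 (T - of_nat m)) m)"
    by (simp only: fps_mult_left_const_nth)
  also have "\<dots> = fps_const ((- 1) ^ m * (T gchoose m)) *
      (fps_const (fps_nth (one_minus_pow c S * one_minus_pow 1 (T - of_nat m)) m)
       * (one_minus_pow 1 R * one_minus_pow 1 (S + (T - of_nat m) - of_nat m)))"
    unfolding two_var_pow_mult_nth by (simp only: mult_ac)
  also have "one_minus_pow 1 R * one_minus_pow 1 (S + (T - of_nat m) - of_nat m) = 
      one_minus_pow 1 (R + S + T - 2 * of_nat m)"
    unfolding one_minus_pow_mult by (simp add: algebra_simps)
  finally show ?thesis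
    by (simp add: Diag_def coeff3_def mult.assoc)
qed

section \<open>Multiplication formulas for Pochhammer symbols\<close>

lemma pochhammer_triple:
  fixes z :: "'a::field_char_0"
  shows "pochhammer z (3 * n) =
    27 ^ n * pochhammer (z / 3) n * pochhammer ((z + 1) / 3) n * pochhammer ((z + 2) / 3) n"
proof (induction n)
  case (Suc n)
  have "3 * Suc n = Suc (Suc (Suc (3 * n)))" by simp
  then have "pochhammer z (3 * Suc n) = 
      pochhammer z (3 * n) * ((z + 3 * of_nat n) * (z + 3 * of_nat n + 1) * (z + 3 * of_nat n + 2))"
    by (simp only: pochhammer_Suc) (simp add: algebra_simps)
  also have "(z + 3 * of_nat n) * (z + 3 * of_nat n + 1) * (z + 3 * of_nat n + 2) =
      27 * (z / 3 + of_nat n) * ((z + 1) / 3 + of_nat n) * ((z + 2) / 3 + of_nat n)"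
    by (simp add: field_simps)
  finally show ?case
    unfolding Suc.IH by (simp add: pochhammer_Suc)
qed simp

lemma pochhammer_double_half:
  fixes z :: "'a::field_char_0"
  shows "pochhammer z (2 * n) = 4 ^ n * pochhammer (z / 2) n * pochhammer ((z + 1) / 2) n"
  using pochhammer_double[of "z / 2" n] by (simp add: power_mult add_divide_distrib)

lemma minus_one_power_gbinomial:
  fixes a :: "'a::field_char_0"
  shows "(- 1) ^ n * (a gchoose n) = pochhammer (- a) n / fact n"
  by (simp add: gbinomial_pochhammer flip: mult.assoc power_add mult_2)

lemma hypergeo_defined_pochhammer:
  assumes "hypergeo_defined bs" "b \<in> set bs"
  shows "pochhammer b n \<noteq> 0"
  using assms unfolding hypergeo_defined_def pochhammer_eq_0_iff by (metis add.left_inverse)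

text \<open>The left side is (N + 2m)_m / m! = (N)_(3m) / ((N)_(2m) m!), to which the triplication
  and duplication formulas apply; the hypotheses say that (N)_(2m) is nonzero.\<close>

lemma shifted_gbinomial_triple:
  fixes N :: rat
  assumes "pochhammer (N / 2) m \<noteq> 0" "pochhammer ((N + 1) / 2) m \<noteq> 0"
  shows "(- 1) ^ m * (- N - 2 * of_nat m gchoose m) =
    27 ^ m * pochhammer (N / 3) m * pochhammer ((N + 1) / 3) m * pochhammer ((N + 2) / 3) m /
      (4 ^ m * pochhammer (N / 2) m * pochhammer ((N + 1) / 2) m * fact m)"
proof -
  have "pochhammer N (3 * m) = pochhammer N (2 * m) * pochhammer (N + 2 * of_nat m) m"
    using pochhammer_product'[of N "2 * m" m] by simp
  then show ?thesis
    using assms unfolding minus_one_power_gbinomial pochhammer_triple pochhammer_double_half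
    by (simp add: field_simps)
qed

text \<open>Likewise (M + m)_m = (M)_(2m) / (M)_m, followed by duplication.\<close>

lemma shifted_gbinomial_double:
  fixes M :: rat
  assumes "pochhammer M m \<noteq> 0"
  shows "(- 1) ^ m * (- M - of_nat m gchoose m) =
    4 ^ m * pochhammer (M / 2) m * pochhammer ((M + 1) / 2) m / (pochhammer M m * fact m)"
proof -
  have "pochhammer M (2 * m) = pochhammer M m * pochhammer (M + of_nat m) m"
    using pochhammer_product'[of M m m] by (simp add: mult_2)
  then show ?thesis
    using assms unfolding minus_one_power_gbinomial pochhammer_double_half
    by (simp add: field_simps)
qed

section \<open>The two hypergeometric identities\<close>

lemma Diag_pow3_eq_hypergeo_6F5:
  assumes "hypergeo_defined [- (R + S + T) / 2, (1 - (R + S + T)) / 2, - (S + T), 1, 1]"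
  shows "Diag ((1 - X3) pow3 R * (1 - X3 - Y3) pow3 S * (1 - X3 - Y3 - Z3) pow3 T) =
       fps_hypergeo
         [- (R + S + T) / 3, (1 - (R + S + T)) / 3, (2 - (R + S + T)) / 3,
          - (S + T) / 2, (1 - (S + T)) / 2, - T]
         [- (R + S + T) / 2, (1 - (R + S + T)) / 2, - (S + T), 1, 1]
         27"
proof (rule fps_ext)
  fix m
  define N M where "N = - (R + S + T)" and "M = - (S + T)"
  note nz = hypergeo_defined_pochhammer[OF assms, of _ m]
  have nz': "pochhammer (N / 2) m \<noteq> 0" "pochhammer ((N + 1) / 2) m \<noteq> 0" "pochhammer M m \<noteq> 0"
    using nz[of "N / 2"] nz[of "(N + 1) / 2"] nz[of M] by (simp_all add: N_def M_def)
  have "fps_nth (Diag ((1 - X3) pow3 R * (1 - X3 - Y3) pow3 S * (1 - X3 - Y3 - Z3) pow3 T)) m =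
      (- 1) ^ m * (T gchoose m) * ((- 1) ^ m * (- M - of_nat m gchoose m))
      * ((- 1) ^ m * (- N - 2 * of_nat m gchoose m))"
    using Diag_nth[of R 1 S T m] by (simp add: one_minus_pow_mult N_def M_def algebra_simps)
  also have "\<dots> = fps_nth (fps_hypergeo
         [N / 3, (N + 1) / 3, (N + 2) / 3, M / 2, (M + 1) / 2, - T]
         [N / 2, (N + 1) / 2, M, 1, 1] 27) m"
    \<comment> \<open>The powers of 4 cancel. Of the three factors m!, two are (1)_m for the lower
      parameters 1, 1 and the third belongs to the hypergeometric term.\<close>
    unfolding shifted_gbinomial_triple[OF nz'(1,2)] shifted_gbinomial_double[OF nz'(3)]
      minus_one_power_gbinomial[of m T]
    using nz' by (simp add: pochhammer_fact[symmetric] field_simps)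
  finally show "fps_nth (Diag ((1 - X3) pow3 R * (1 - X3 - Y3) pow3 S * (1 - X3 - Y3 - Z3) pow3 T)) m =
      fps_nth (fps_hypergeo
         [- (R + S + T) / 3, (1 - (R + S + T)) / 3, (2 - (R + S + T)) / 3,
          - (S + T) / 2, (1 - (S + T)) / 2, - T]
         [- (R + S + T) / 2, (1 - (R + S + T)) / 2, - (S + T), 1, 1]
         27) m"
    by (simp only: N_def M_def uminus_add_conv_diff)
qed

lemma Diag_pow3_eq_hypergeo_4F3:
  assumes "hypergeo_defined [(1 - (R + S)) / 2, (2 - (R + S)) / 2, 1]"
  shows "Diag ((1 - X3) pow3 R * (1 - X3 - 2 * Y3) pow3 S * (1 - X3 - Y3 - Z3) pow3 (- 1)) =
       fps_hypergeo
         [(1 - (R + S)) / 3, (2 - (R + S)) / 3, (3 - (R + S)) / 3, (1 - S) / 2]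
         [(1 - (R + S)) / 2, (2 - (R + S)) / 2, 1]
         27"
proof (rule fps_ext)
  fix m
  \<comment> \<open>This is -(R + S + T) at T = -1, where T - m also becomes the exponent -1 - m
    required by the Lagrange inversion.\<close>
  define N where "N = 1 - (R + S)"
  have N: "2 - (R + S) = N + 1" "3 - (R + S) = N + 2" by (simp_all add: N_def)
  note nz = hypergeo_defined_pochhammer[OF assms, of _ m]
  have nz': "pochhammer (N / 2) m \<noteq> 0" "pochhammer ((N + 1) / 2) m \<noteq> 0"
    using nz[of "N / 2"] nz[of "(N + 1) / 2"] by (simp_all add: N_def)
  \<comment> \<open>The factor 4^m obtained here cancels the one in the denominator of
    \<open>shifted_gbinomial_triple\<close>.\<close>
  have S: "(- 4) ^ m * (((S - 1) / 2) gchoose m) = 4 ^ m * (pochhammer ((1 - S) / 2) m / fact m)"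
    using minus_one_power_gbinomial[of m "(S - 1) / 2"] power_mult_distrib[of "- 1" "4::rat" m]
    by (simp add: mult.left_commute[of "(- 1) ^ m"] mult.assoc minus_divide_left)
  have T: "(- 1) ^ m * ((- 1 :: rat) gchoose m) = 1"
    unfolding minus_one_power_gbinomial by (simp add: pochhammer_fact[symmetric])
  have "fps_const (fps_const (fps_const 2)) = (2 :: fps3)"
    by (simp add: numeral_fps_const)
  moreover have "R + S + - 1 - 2 * of_nat m = - N - 2 * of_nat m"
    by (simp add: N_def)
  ultimately have "fps_nth (Diag ((1 - X3) pow3 R * (1 - X3 - 2 * Y3) pow3 S * (1 - X3 - Y3 - Z3) pow3 (- 1))) m =
      (- 4) ^ m * (((S - 1) / 2) gchoose m) * ((- 1) ^ m * (- N - 2 * of_nat m gchoose m))"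
    using Diag_nth[of R 2 S "- 1" m] by (simp only: coeff_one_minus_pow_2_mult T mult_1)
  also have "\<dots> = fps_nth (fps_hypergeo [N / 3, (N + 1) / 3, (N + 2) / 3, (1 - S) / 2]
         [N / 2, (N + 1) / 2, 1] 27) m"
    unfolding shifted_gbinomial_triple[OF nz'] S
    using nz' by (simp add: pochhammer_fact[symmetric] field_simps)
  finally show "fps_nth (Diag ((1 - X3) pow3 R * (1 - X3 - 2 * Y3) pow3 S * (1 - X3 - Y3 - Z3) pow3 (- 1))) m =
       fps_nth (fps_hypergeo
         [(1 - (R + S)) / 3, (2 - (R + S)) / 3, (3 - (R + S)) / 3, (1 - S) / 2]
         [(1 - (R + S)) / 2, (2 - (R + S)) / 2, 1]
         27) m"
    unfolding N N_def[symmetric] .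
qed

theorem theorem2:
  fixes R S T :: rat
  shows
    "(hypergeo_defined [- (R + S + T) / 2, (1 - (R + S + T)) / 2, - (S + T), 1, 1] \<longrightarrow>
       Diag ((1 - X3) pow3 R * (1 - X3 - Y3) pow3 S * (1 - X3 - Y3 - Z3) pow3 T) =
       fps_hypergeo
         [- (R + S + T) / 3, (1 - (R + S + T)) / 3, (2 - (R + S + T)) / 3,
          - (S + T) / 2, (1 - (S + T)) / 2, - T]
         [- (R + S + T) / 2, (1 - (R + S + T)) / 2, - (S + T), 1, 1]
         27) \<and>
     (hypergeo_defined [(1 - (R + S)) / 2, (2 - (R + S)) / 2, 1] \<longrightarrow>
       Diag ((1 - X3) pow3 R * (1 - X3 - 2 * Y3) pow3 S * (1 - X3 - Y3 - Z3) pow3 (- 1)) =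
       fps_hypergeo
         [(1 - (R + S)) / 3, (2 - (R + S)) / 3, (3 - (R + S)) / 3, (1 - S) / 2]
         [(1 - (R + S)) / 2, (2 - (R + S)) / 2, 1]
         27)"
  using Diag_pow3_eq_hypergeo_6F5 Diag_pow3_eq_hypergeo_4F3 by blast

end
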